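(* Let $G$ be a finite simple graph with exactly two holes. Then the competition number of $G$ satisfies $k(G) \le 3$.
   Context: For an acyclic digraph $D$, the competition graph $C(D)$ is the graph with vertex set $V(D)$ in which distinct vertices $x,y$ are adjacent if and only if there is a vertex $v$ with $(x,v)$ and $(y,v)$ both arcs of $D$. For a graph $G$, the competition number $k(G)$ is the smallest nonnegative integer $k$ such that $G$ together with $k$ new isolated vertices is the competition graph of some acyclic digraph. A hole of a graph is an induced subgraph that is a cycle of length at least $4$. *)

theory Defs
  imports Main
begin

type_synonym 'a sgraph = "'a set \<times> 'a set set"

type_synonym 'a dgraph = "'a set \<times> ('a \<times> 'a) set"

definition finite_simple_graph :: "'a sgraph \<Rightarrow> bool" where
  "finite_simple_graph G \<longleftrightarrow>
     finite (fst G) \<and> (\<forall>e \<in> snd G. e \<subseteq> fst G \<and> card e = 2)"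

definition acyclic_digraph :: "'a dgraph \<Rightarrow> bool" where
  "acyclic_digraph D \<longleftrightarrow> snd D \<subseteq> fst D \<times> fst D \<and> acyclic (snd D)"

definition competition_graph :: "'a dgraph \<Rightarrow> 'a sgraph" where
  "competition_graph D =
     (fst D, {{x, y} | x y. x \<in> fst D \<and> y \<in> fst D \<and> x \<noteq> y \<and>
                (\<exists>v \<in> fst D. (x, v) \<in> snd D \<and> (y, v) \<in> snd D)})"

definition add_isolated :: "'a sgraph \<Rightarrow> nat \<Rightarrow> ('a + nat) sgraph" where
  "add_isolated G k = (Inl ` fst G \<union> Inr ` {..<k}, (\<lambda>e. Inl ` e) ` snd G)"

definition competition_number :: "'a sgraph \<Rightarrow> nat" where
  "competition_number G =
     (LEAST k. \<exists>D. acyclic_digraph D \<and> competition_graph D = add_isolated G k)"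

definition induced_subgraph :: "'a sgraph \<Rightarrow> 'a set \<Rightarrow> 'a sgraph" where
  "induced_subgraph G W = (W, {e \<in> snd G. e \<subseteq> W})"

definition is_cycle_graph :: "nat \<Rightarrow> 'a sgraph \<Rightarrow> bool" where
  "is_cycle_graph n H \<longleftrightarrow> 3 \<le> n \<and>
     (\<exists>c. bij_betw c {..<n} (fst H) \<and> snd H = {{c i, c (Suc i mod n)} | i. i < n})"

definition holes :: "'a sgraph \<Rightarrow> 'a sgraph set" where
  "holes G = {H. (\<exists>W \<subseteq> fst G. H = induced_subgraph G W) \<and> (\<exists>n \<ge> 4. is_cycle_graph n H)}"

text \<open>The minimum defining the competition number is attained: with one new vertex per
  edge, let both ends of each edge point to the new vertex of that edge.\<close>

lemma competition_number_exists:
  assumes "finite_simple_graph G"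
  shows "\<exists>k D. acyclic_digraph D \<and> competition_graph D = add_isolated G k"
proof -
  obtain V E where G: "G = (V, E)" by (cases G)
  have V: "finite V" and E: "\<And>e. e \<in> E \<Longrightarrow> e \<subseteq> V \<and> card e = 2"
    using assms by (auto simp: G finite_simple_graph_def)
  have "finite E"
    by (rule finite_subset[of _ "Pow V"]) (use V E in auto)
  then obtain h where h: "bij_betw h E {..<card E}"
    using ex_bij_betw_finite_nat[of E] by (auto simp: atLeast0LessThan)
  define A :: "(('a + nat) \<times> ('a + nat)) set"
    where "A = {(Inl x, Inr (h e)) | x e. e \<in> E \<and> x \<in> e}"
  define W :: "('a + nat) set" where "W = Inl ` V \<union> Inr ` {..<card E}"
  have hE: "h e < card E" if "e \<in> E" for e
    using h that by (auto simp: bij_betw_def)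
  have hinj: "e = f" if "h e = h f" "e \<in> E" "f \<in> E" for e f
    using h that by (auto simp: bij_betw_def inj_on_def)
  have sub: "A \<subseteq> W \<times> W"
    using E hE by (auto simp: A_def W_def)
  have "A \<subseteq> (measure (\<lambda>z. case z of Inl _ \<Rightarrow> 1 | Inr _ \<Rightarrow> 0))\<inverse>"
    by (auto simp: A_def)
  then have acyc: "acyclic A"
    by (rule acyclic_subset[rotated]) (simp add: acyclic_converse wf_acyclic)
  have eq: "{{x, y} | x y. x \<in> W \<and> y \<in> W \<and> x \<noteq> y \<and> (\<exists>v \<in> W. (x, v) \<in> A \<and> (y, v) \<in> A)}
          = (\<lambda>e. Inl ` e) ` E" (is "?L = ?R")
  proof
    show "?L \<subseteq> ?R"
    proof
      fix s assume "s \<in> ?L"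
      then obtain x y v where s: "s = {x, y}" "x \<noteq> y" "(x, v) \<in> A" "(y, v) \<in> A" by blast
      obtain a e where 1: "x = Inl a" "v = Inr (h e)" "e \<in> E" "a \<in> e"
        using s(3) by (auto simp: A_def)
      obtain b f where 2: "y = Inl b" "v = Inr (h f)" "f \<in> E" "b \<in> f"
        using s(4) by (auto simp: A_def)
      have "e = f" using 1 2 hinj by simp
      then have ss: "{a, b} \<subseteq> e" and ab: "card {a, b} = 2"
        using 1 2 s(2) by auto
      have "card e = 2" using 1 E by blast
      then have "{a, b} = e"
        using ss ab by (intro card_subset_eq) (auto intro: card_ge_0_finite)
      then have "s = Inl ` e" using s(1) 1 2 by auto
      then show "s \<in> ?R" using 1(3) by blast
    qed
    show "?R \<subseteq> ?L"
    proof
      fix s assume "s \<in> ?R"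
      then obtain e where e: "e \<in> E" "s = Inl ` e" by blast
      then obtain a b where ab: "e = {a, b}" "a \<noteq> b" using E[of e] by (auto simp: card_2_iff)
      have "(Inl a, Inr (h e)) \<in> A" "(Inl b, Inr (h e)) \<in> A"
        using e ab by (auto simp: A_def)
      moreover from this have "Inl a \<in> W" "Inl b \<in> W" "Inr (h e) \<in> W"
        using sub by auto
      moreover have "s = {Inl a, Inl b}" "Inl a \<noteq> Inl b" using e ab by auto
      ultimately show "s \<in> ?L" unfolding mem_Collect_eq
        by (intro exI[of _ "Inl a"] exI[of _ "Inl b"]) auto
    qed
  qed
  have "acyclic_digraph (W, A)" using sub acyc by (simp add: acyclic_digraph_def)
  moreover have "competition_graph (W, A) = add_isolated G (card E)"
    using eq by (simp add: competition_graph_def add_isolated_def G W_def)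
  ultimately show ?thesis by blast
qed

end

theory Submission
  imports Defs
begin

text \<open>
  Every nonempty finite graph has a vertex \<open>v\<close> such that any two nonadjacent neighbours \<open>s\<close>, \<open>t\<close>
  of \<open>v\<close> are joined by a path whose inner vertices lie outside the closed neighbourhood of \<open>v\<close>
  (an avoidable vertex). A shortest such path closes up with \<open>v\<close> to a hole in which \<open>s\<close> and \<open>t\<close>
  are the neighbours of \<open>v\<close>, so if the neighbourhood of \<open>v\<close> has \<open>m\<close> nonadjacent pairs then at
  least \<open>m\<close> holes pass through \<open>v\<close>. The neighbourhood can be split into \<open>m + 1\<close> cliques. Delete
  \<open>v\<close>, represent the rest by induction, replace one of the added isolated vertices by \<open>v\<close>, and
  let the \<open>m + 1\<close> cliques at \<open>v\<close> prey on that vertex and on \<open>m\<close> further ones. In total a graph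
  with \<open>h\<close> holes needs at most \<open>h + 1\<close> added vertices.
\<close>

section \<open>Detours and avoidable vertices\<close>

definition detour :: "'a set set \<Rightarrow> 'a set \<Rightarrow> 'a \<Rightarrow> 'a \<Rightarrow> 'a \<Rightarrow> nat \<Rightarrow> (nat \<Rightarrow> 'a) \<Rightarrow> bool" where
  "detour E V v s t n p \<longleftrightarrow> p 0 = s \<and> p n = t \<and> (\<forall>i<n. {p i, p (Suc i)} \<in> E) \<and>
     (\<forall>i. 0 < i \<and> i < n \<longrightarrow> p i \<in> V \<and> p i \<noteq> v \<and> {v, p i} \<notin> E)"

definition avoidable :: "'a set set \<Rightarrow> 'a set \<Rightarrow> 'a \<Rightarrow> bool" where
  "avoidable E V v \<longleftrightarrow> v \<in> V \<and>
     (\<forall>s\<in>V. \<forall>t\<in>V. {v, s} \<in> E \<and> {v, t} \<in> E \<and> s \<noteq> t \<and> {s, t} \<notin> E \<longrightarrow>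
        (\<exists>n p. detour E V v s t n p))"

definition connected_in :: "'a set set \<Rightarrow> 'a set \<Rightarrow> bool" where
  "connected_in E C \<longleftrightarrow> (\<forall>x\<in>C. \<forall>y\<in>C. (x, y) \<in> {(a, b). a \<in> C \<and> b \<in> C \<and> {a, b} \<in> E}\<^sup>*)"

text \<open>An induced subgraph is determined by its vertex set, so holes can be counted as sets.
  \<open>E\<close> stays fixed while \<open>V\<close> shrinks in the inductions; only edges inside
  \<open>V\<close> matter.\<close>

definition hole_sets :: "'a set set \<Rightarrow> 'a set \<Rightarrow> 'a set set" where
  "hole_sets E V = {W. W \<subseteq> V \<and> (\<exists>n\<ge>4. is_cycle_graph n (W, {e \<in> E. e \<subseteq> W}))}"

lemma connected_in_insert:
  assumes "connected_in E C" "c \<in> C" "{s, c} \<in> E"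
  shows "connected_in E (insert s C)"
proof -
  let ?R = "{(a, b). a \<in> C \<and> b \<in> C \<and> {a, b} \<in> E}"
  let ?R' = "{(a, b). a \<in> insert s C \<and> b \<in> insert s C \<and> {a, b} \<in> E}"
  have mono: "?R\<^sup>* \<subseteq> ?R'\<^sup>*" by (rule rtrancl_mono) auto
  have C: "(x, y) \<in> ?R'\<^sup>*" if "x \<in> C" "y \<in> C" for x y
    using assms(1) that mono unfolding connected_in_def by blast
  have sc: "(s, c) \<in> ?R'" "(c, s) \<in> ?R'"
    using assms by (auto simp: insert_commute)
  have "(s, y) \<in> ?R'\<^sup>*" "(y, s) \<in> ?R'\<^sup>*" if "y \<in> C" for y
    using C[OF assms(2) that] C[OF that assms(2)] sc
    by (meson converse_rtrancl_into_rtrancl rtrancl_into_rtrancl)+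
  then show ?thesis
    unfolding connected_in_def using C by blast
qed

lemma detour_through_connected:
  assumes C: "connected_in E C" "C \<subseteq> V" and ends: "a \<in> C" "b \<in> C" "{s, a} \<in> E" "{t, b} \<in> E"
    and avoid: "\<And>c. c \<in> C \<Longrightarrow> c \<noteq> v \<and> {v, c} \<notin> E"
  shows "\<exists>n p. detour E V v s t n p"
proof -
  let ?R = "{(a, b). a \<in> C \<and> b \<in> C \<and> {a, b} \<in> E}"
  have "(a, b) \<in> ?R\<^sup>*" using C ends by (auto simp: connected_in_def)
  then obtain n where "(a, b) \<in> ?R ^^ n" using rtrancl_imp_relpow by blast
  then obtain f where f: "f 0 = a" "f n = b" "\<And>i. i < n \<Longrightarrow> (f i, f (Suc i)) \<in> ?R"
    by (auto simp: relpow_fun_conv)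
  have fC: "f i \<in> C" if "i \<le> n" for i
  proof (cases "i < n")
    case True then show ?thesis using f(3) by auto
  next
    case False then show ?thesis using that f ends by (simp add: le_antisym)
  qed
  \<comment> \<open>The walk is \<open>s\<close>, \<open>f 0\<close>, ..., \<open>f n\<close>,
    \<open>t\<close>, hence of length \<open>n + 2\<close>.\<close>
  define p where "p i = (if i = 0 then s else if i \<le> Suc n then f (i - 1) else t)" for i
  have "{p i, p (Suc i)} \<in> E" if i: "i < n + 2" for i
  proof -
    consider "i = 0" | "0 < i" "i \<le> n" | "i = Suc n" using i by linarith
    then show ?thesis
    proof cases
      case 1 then show ?thesis using f ends by (simp add: p_def)
    next
      case 2
      then obtain j where "i = Suc j" by (cases i) auto
      then show ?thesis using f(3)[of j] 2 by (simp add: p_def)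
    next
      case 3 then show ?thesis using f ends by (simp add: p_def insert_commute)
    qed
  qed
  moreover have "p i \<in> C" if "0 < i" "i < n + 2" for i
    using that fC by (auto simp: p_def)
  ultimately have "detour E V v s t (n + 2) p"
    using C avoid unfolding detour_def by (auto simp: p_def)
  then show ?thesis by blast
qed

text \<open>
  Take a vertex \<open>u\<close> and a largest connected set \<open>C\<close> that misses the closed neighbourhood of \<open>u\<close>.
  By maximality, every vertex outside \<open>C\<close> with a neighbour in \<open>C\<close> is adjacent to every vertex
  of the remaining set \<open>R\<close>, so an avoidable vertex of \<open>R\<close> is avoidable in the whole graph.
\<close>

lemma avoidable_vertex_exists:
  assumes "finite V" "V \<noteq> {}"
  shows "\<exists>v. avoidable E V v"
  using assms
proof (induction V rule: finite_psubset_induct)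
  case (psubset V)
  define P where "P = (\<lambda>(u, C). u \<in> V \<and> C \<subseteq> V \<and> C \<noteq> {} \<and> connected_in E C \<and>
    (\<forall>c\<in>C. c \<noteq> u \<and> {u, c} \<notin> E))"
  show ?case
  proof (cases "\<exists>uC. P uC")
    case False
    \<comment> \<open>A nonadjacent pair would satisfy \<open>P\<close> through a singleton, so here
      the graph is complete and avoidability is vacuous.\<close>
    have adj: "{u, w} \<in> E" if "u \<in> V" "w \<in> V" "u \<noteq> w" for u w
    proof (rule ccontr)
      assume "{u, w} \<notin> E"
      then have "P (u, {w})" using that by (auto simp: P_def connected_in_def)
      then show False using False by blast
    qed
    obtain v where "v \<in> V" using psubset.prems by blast
    then have "avoidable E V v" using adj by (auto simp: avoidable_def)
    then show ?thesis by blast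
  next
    case True
    then obtain uC where "P uC" by blast
    moreover have "\<forall>uC. P uC \<longrightarrow> card (snd uC) < Suc (card V)"
      using psubset.hyps by (auto simp: P_def less_Suc_eq_le intro: card_mono)
    ultimately obtain uC where uC: "P uC" "\<forall>z. P z \<longrightarrow> card (snd z) \<le> card (snd uC)"
      using ex_has_greatest_nat[of P uC "\<lambda>z. card (snd z)"] by blast
    obtain u C where "uC = (u, C)" by (cases uC)
    with uC have P: "P (u, C)" and max: "\<And>w B. P (w, B) \<Longrightarrow> card B \<le> card C" by force+
    have C: "u \<in> V" "C \<subseteq> V" "C \<noteq> {}" "connected_in E C"
      and uC: "\<And>c. c \<in> C \<Longrightarrow> c \<noteq> u \<and> {u, c} \<notin> E"
      using P by (auto simp: P_def)
    have finC: "finite C" using C psubset.hyps finite_subset by blast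
    define S where "S = {s \<in> V - C. \<exists>c\<in>C. {s, c} \<in> E}"
    define R where "R = V - (C \<union> S)"
    have RC: "c \<noteq> w \<and> {w, c} \<notin> E" if "w \<in> R" "c \<in> C" for w c
      using that by (auto simp: R_def S_def)
    \<comment> \<open>The maximum is over \<open>u\<close> as well as \<open>C\<close>: if
      \<open>w\<close> were not adjacent to \<open>s\<close>, then \<open>insert s C\<close> would
      be a larger connected set missing the closed neighbourhood of \<open>w\<close>.\<close>
    have RS: "{w, s} \<in> E" if ws: "w \<in> R" "s \<in> S" for w s
    proof (rule ccontr)
      assume no: "{w, s} \<notin> E"
      obtain c where c: "c \<in> C" "{s, c} \<in> E" and s: "s \<in> V" "s \<notin> C"
        using ws by (auto simp: S_def)
      have "P (w, insert s C)"
        using ws no s C RC[OF ws(1)] connected_in_insert[OF C(4) c]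
        by (auto simp: P_def R_def)
      then have "card (insert s C) \<le> card C" by (rule max)
      then show False using s finC by simp
    qed
    have "u \<in> R" using C uC by (auto simp: R_def S_def)
    moreover have "R \<subset> V" using C by (auto simp: R_def)
    ultimately obtain v where v: "avoidable E R v" using psubset.IH[of R] by blast
    have vR: "v \<in> R" using v by (simp add: avoidable_def)
    have "\<exists>n p. detour E V v s t n p"
      if st: "s \<in> V" "t \<in> V" "{v, s} \<in> E" "{v, t} \<in> E" "s \<noteq> t" "{s, t} \<notin> E" for s t
    proof -
      have "s \<in> R \<union> S" "t \<in> R \<union> S" using RC[OF vR] st by (auto simp: R_def)
      \<comment> \<open>A mixed pair would be adjacent by \<open>RS\<close>. Two vertices of
        \<open>S\<close> are joined through \<open>C\<close>, two of \<open>R\<close> by the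
        avoidability of \<open>v\<close> in \<open>R\<close>.\<close>
      then consider "s \<in> S" "t \<in> S" | "s \<in> R" "t \<in> R"
        using RS[of s t] RS[of t s] st(6) by (auto simp: insert_commute)
      then show ?thesis
      proof cases
        case 1
        then obtain a b where "a \<in> C" "b \<in> C" "{s, a} \<in> E" "{t, b} \<in> E"
          by (auto simp: S_def)
        then show ?thesis using detour_through_connected[OF C(4,2)] RC[OF vR] by blast
      next
        case 2
        then obtain n p where "detour E R v s t n p"
          using v st unfolding avoidable_def by blast
        then have "detour E V v s t n p" by (auto simp: detour_def R_def)
        then show ?thesis by blast
      qed
    qed
    then have "avoidable E V v" using vR by (auto simp: avoidable_def R_def)
    then show ?thesis by blast
  qed
qed

section \<open>From shortest detours to holes\<close>

text \<open>A detour is only a walk, but cutting out the piece between \<open>p i\<close> and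
  \<open>p j\<close> shortens it. Hence a shortest detour is an induced path.\<close>

lemma detour_shortcut:
  assumes p: "detour E V v s t n p" and ij: "i < j" "j \<le> n"
    and chord: "p i = p j \<or> ({p i, p j} \<in> E \<and> j \<noteq> Suc i)"
  shows "\<exists>m<n. \<exists>q. detour E V v s t m q"
proof (cases "p i = p j")
  case True
  define d where "d = j - i"
  define q where "q k = (if k \<le> i then p k else p (k + d))" for k
  have d: "0 < d" "i + d = j" using ij by (auto simp: d_def)
  have E: "{q k, q (Suc k)} \<in> E" if "k < n - d" for k
  proof -
    consider "k < i" | "k = i" | "i < k" by linarith
    then show ?thesis
    proof cases
      case 2
      then have "q k = p j" "q (Suc k) = p (Suc j)" "j < n"
        using True d that by (auto simp: q_def)
      then show ?thesis using p by (auto simp: detour_def)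
    qed (use p that ij d in \<open>auto simp: detour_def q_def\<close>)
  qed
  \<comment> \<open>If \<open>j = n\<close>, the new walk stops at index \<open>i\<close>, where
    \<open>q\<close> still takes the value \<open>p i\<close>, equal to \<open>p n\<close>.\<close>
  have "q (n - d) = p n"
    using True d ij by (cases "j = n") (auto simp: q_def)
  with E have "detour E V v s t (n - d) q"
    using p d ij by (auto simp: detour_def q_def)
  then show ?thesis using d ij by (intro exI[of _ "n - d"]) auto
next
  case False
  \<comment> \<open>The step from \<open>p i\<close> to \<open>p j\<close> remains as an edge, so
    one index fewer is skipped than in the first case; \<open>j \<noteq> Suc i\<close> keeps
    \<open>d\<close> positive.\<close>
  define d where "d = j - Suc i"
  define q where "q k = (if k \<le> i then p k else p (k + d))" for k
  have d: "0 < d" "Suc i + d = j" using ij chord False by (auto simp: d_def)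
  have E: "{q k, q (Suc k)} \<in> E" if "k < n - d" for k
  proof -
    consider "k < i" | "k = i" | "i < k" by linarith
    then show ?thesis
    proof cases
      case 2
      then show ?thesis using chord False d by (auto simp: q_def)
    qed (use p that ij d in \<open>auto simp: detour_def q_def\<close>)
  qed
  have "detour E V v s t (n - d) q"
    using E p d ij by (auto simp: detour_def q_def)
  then show ?thesis using d ij by (intro exI[of _ "n - d"]) auto
qed

text \<open>A shortest detour is an induced path that meets the neighbourhood of \<open>v\<close>
  only in its ends, so \<open>v\<close> closes it to a hole. The hole determines
  \<open>{s, t}\<close>, so different pairs give different holes.\<close>

lemma hole_from_detour:
  assumes E: "\<forall>e\<in>E. card e = 2" and v: "v \<in> V" and st: "s \<in> V" "t \<in> V"
    and nb: "{v, s} \<in> E" "{v, t} \<in> E" and non: "s \<noteq> t" "{s, t} \<notin> E"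
    and ex: "\<exists>n p. detour E V v s t n p"
  shows "\<exists>W \<in> hole_sets E V. v \<in> W \<and> {x \<in> W. {v, x} \<in> E} = {s, t}"
proof -
  define n where "n = (LEAST n. \<exists>p. detour E V v s t n p)"
  obtain p where p: "detour E V v s t n p"
    using LeastI_ex[OF ex] unfolding n_def by blast
  have min: "\<not> detour E V v s t m q" if "m < n" for m q
    using not_less_Least[of m "\<lambda>n. \<exists>p. detour E V v s t n p"] that unfolding n_def by blast
  have irr: "{x, x} \<notin> E" for x using E by force
  have p0: "p 0 = s" and pn: "p n = t" and pE: "\<And>i. i < n \<Longrightarrow> {p i, p (Suc i)} \<in> E"
    and pin: "\<And>i. 0 < i \<Longrightarrow> i < n \<Longrightarrow> p i \<in> V \<and> p i \<noteq> v \<and> {v, p i} \<notin> E"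
    using p by (auto simp: detour_def)
  have ne: "p i \<noteq> p j" and chord: "{p i, p j} \<in> E \<Longrightarrow> j = Suc i" if "i < j" "j \<le> n" for i j
    using detour_shortcut[OF p that] min by blast+
  have n2: "2 \<le> n"
  proof (rule ccontr)
    assume "\<not> 2 \<le> n"
    then consider "n = 0" | "n = 1" by linarith
    then show False using p0 pn pE[of 0] non by cases auto
  qed
  have pv: "p i \<noteq> v" and pV: "p i \<in> V" if i: "i \<le> n" for i
  proof -
    consider "i = 0" | "i = n" | "0 < i" "i < n" using i by linarith
    then have "p i \<noteq> v \<and> p i \<in> V" using p0 pn pin[of i] nb irr[of v] st by cases auto
    then show "p i \<noteq> v" "p i \<in> V" by auto
  qed
  have vadj: "{v, p i} \<in> E \<longleftrightarrow> i = 0 \<or> i = n" if "i \<le> n" for i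
    using that pin[of i] p0 pn nb by (cases "i = 0"; cases "i = n") auto
  \<comment> \<open>The vertex \<open>v\<close> takes index \<open>n + 1\<close> after the path,
    giving a cycle of length \<open>n + 2\<close>, at least 4 by \<open>n2\<close>.\<close>
  define c where "c i = (if i \<le> n then p i else v)" for i
  define W where "W = c ` {..<n + 2}"
  have W: "W = insert v (p ` {..n})"
  proof -
    have "{..<n + 2} = insert (Suc n) {..n}" by auto
    then show ?thesis by (auto simp: W_def c_def)
  qed
  have "inj_on c {..<n + 2}"
  proof (rule linorder_inj_onI')
    fix i j assume "i \<in> {..<n + 2}" "j \<in> {..<n + 2}" "i < j"
    then show "c i \<noteq> c j" using ne[of i j] pv[of i] by (auto simp: c_def)
  qed
  then have bij: "bij_betw c {..<n + 2} W" by (simp add: W_def bij_betw_def)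
  have cyc: "{c i, c (Suc i mod (n + 2))} \<in> E" "{c i, c (Suc i mod (n + 2))} \<subseteq> W"
    if i: "i < n + 2" for i
  proof -
    consider "i < n" | "i = n" | "i = Suc n" using i by linarith
    then show "{c i, c (Suc i mod (n + 2))} \<in> E"
      using pE nb p0 pn by cases (auto simp: c_def insert_commute)
    show "{c i, c (Suc i mod (n + 2))} \<subseteq> W" using i by (auto simp: W_def)
  qed
  have "e \<in> {{c i, c (Suc i mod (n + 2))} | i. i < n + 2}" if e: "e \<in> E" "e \<subseteq> W" for e
  proof -
    obtain x y where xy: "e = {x, y}" "x \<noteq> y" using E e(1) by (auto simp: card_2_iff)
    obtain i0 j0 where ij0: "i0 < n + 2" "j0 < n + 2" "x = c i0" "y = c j0"
      using e(2) xy by (auto simp: W_def)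
    then have "i0 < j0 \<or> j0 < i0" using xy by (metis linorder_neqE_nat)
    then obtain i j where ij: "i < j" "j < n + 2" "e = {c i, c j}"
      using ij0 xy(1) by (metis insert_commute)
    \<comment> \<open>An edge within the path is a path edge by \<open>chord\<close>. Otherwise
      \<open>j\<close> is the index of \<open>v\<close>, and the edge is \<open>{p n, v}\<close> or
      the wrap-around edge \<open>{v, p 0}\<close>.\<close>
    show ?thesis
    proof (cases "j \<le> n")
      case True
      then have "j = Suc i" using chord[of i j] ij e(1) by (auto simp: c_def)
      then have "e = {c i, c (Suc i mod (n + 2))}" "i < n + 2" using ij by auto
      then show ?thesis by blast
    next
      case False
      then have j: "j = Suc n" using ij by simp
      then have "i = 0 \<or> i = n" using vadj[of i] ij e(1) by (auto simp: c_def insert_commute)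
      then have "e = {c i, c (Suc i mod (n + 2))} \<and> i < n + 2 \<or>
          e = {c j, c (Suc j mod (n + 2))} \<and> j < n + 2"
        using ij j by (auto simp: insert_commute)
      then show ?thesis by blast
    qed
  qed
  then have "{e \<in> E. e \<subseteq> W} = {{c i, c (Suc i mod (n + 2))} | i. i < n + 2}"
    using cyc by blast
  then have "is_cycle_graph (n + 2) (W, {e \<in> E. e \<subseteq> W})"
    unfolding is_cycle_graph_def using bij n2 by auto
  moreover have "W \<subseteq> V" using W pV v by auto
  moreover have "4 \<le> n + 2" using n2 by simp
  ultimately have "W \<in> hole_sets E V" unfolding hole_sets_def by blast
  moreover have "{x \<in> W. {v, x} \<in> E} = {s, t}"
    using vadj irr p0 pn nb unfolding W by auto
  moreover have "v \<in> W" by (simp add: W)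
  ultimately show ?thesis by blast
qed

section \<open>Counting holes and splitting a neighbourhood into cliques\<close>

lemma finite_hole_sets: "finite V \<Longrightarrow> finite (hole_sets E V)"
  by (rule finite_subset[of _ "Pow V"]) (auto simp: hole_sets_def)

definition non_edges :: "'a set set \<Rightarrow> 'a set \<Rightarrow> 'a set set" where
  "non_edges E N = {{s, t} | s t. s \<in> N \<and> t \<in> N \<and> s \<noteq> t \<and> {s, t} \<notin> E}"

lemma finite_non_edges: "finite N \<Longrightarrow> finite (non_edges E N)"
  by (rule finite_subset[of _ "Pow N"]) (auto simp: non_edges_def)

text \<open>The holes missing \<open>v\<close> are those of \<open>V - {v}\<close>. Sending a hole
  through \<open>v\<close> to the set of neighbours of \<open>v\<close> on it hits every non-edge of
  the neighbourhood.\<close>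

lemma card_hole_sets_delete_avoidable:
  assumes "finite V" and E: "\<forall>e\<in>E. card e = 2" and v: "avoidable E V v"
  shows "card (hole_sets E (V - {v})) + card (non_edges E {x \<in> V. {v, x} \<in> E})
    \<le> card (hole_sets E V)"
proof -
  let ?N = "{x \<in> V. {v, x} \<in> E}"
  let ?H = "{W \<in> hole_sets E V. v \<in> W}"
  have "non_edges E ?N \<subseteq> (\<lambda>W. {x \<in> W. {v, x} \<in> E}) ` ?H"
  proof
    fix e assume "e \<in> non_edges E ?N"
    then obtain s t where e: "e = {s, t}" "s \<in> V" "t \<in> V" "{v, s} \<in> E" "{v, t} \<in> E"
      "s \<noteq> t" "{s, t} \<notin> E" by (auto simp: non_edges_def)
    have "v \<in> V" "\<exists>n p. detour E V v s t n p" using v e by (auto simp: avoidable_def)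
    then obtain W where "W \<in> hole_sets E V" "v \<in> W" "{x \<in> W. {v, x} \<in> E} = {s, t}"
      using hole_from_detour[OF E _ e(2-7)] by blast
    then show "e \<in> (\<lambda>W. {x \<in> W. {v, x} \<in> E}) ` ?H"
      by (intro image_eqI[of _ _ W]) (auto simp: e(1))
  qed
  moreover have finH: "finite ?H" using finite_hole_sets[OF assms(1)] by simp
  ultimately have "card (non_edges E ?N) \<le> card ?H" by (rule surj_card_le[rotated])
  moreover have "card (hole_sets E V) = card (hole_sets E (V - {v})) + card ?H"
  proof -
    have "hole_sets E V = hole_sets E (V - {v}) \<union> ?H" by (auto simp: hole_sets_def)
    moreover have "hole_sets E (V - {v}) \<inter> ?H = {}" by (auto simp: hole_sets_def)
    ultimately show ?thesis
      using card_Un_disjoint[OF finite_hole_sets[of "V - {v}" E] finH] assms(1) by simp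
  qed
  ultimately show ?thesis by simp
qed

text \<open>Greedy colouring whose classes are cliques: a new vertex needs a new colour only if it
  brings a new non-edge, which pays for it.\<close>

lemma clique_partition:
  assumes "finite N"
  shows "\<exists>f. (\<forall>x\<in>N. f x \<le> card (non_edges E N)) \<and>
    (\<forall>x\<in>N. \<forall>y\<in>N. f x = (f y :: nat) \<and> x \<noteq> y \<longrightarrow> {x, y} \<in> E)"
  using assms
proof (induction N rule: finite_induct)
  case empty
  then show ?case by simp
next
  case (insert a N)
  let ?m = "card (non_edges E N)"
  obtain f where f: "\<And>x. x \<in> N \<Longrightarrow> f x \<le> ?m"
    "\<And>x y. x \<in> N \<Longrightarrow> y \<in> N \<Longrightarrow> f x = f y \<Longrightarrow> x \<noteq> y \<Longrightarrow> {x, y} \<in> E"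
    using insert.IH by blast
  have sub: "non_edges E N \<subseteq> non_edges E (insert a N)"
    by (auto simp: non_edges_def)
  have fin: "finite (non_edges E (insert a N))"
    using insert by (simp add: finite_non_edges)
  have mono: "?m \<le> card (non_edges E (insert a N))"
    using sub fin card_mono by blast
  show ?case
  proof (cases "\<exists>b\<in>N. {a, b} \<notin> E")
    case False
    then have a: "{a, x} \<in> E" "{x, a} \<in> E" if "x \<in> N" for x
      using that by (auto simp: insert_commute)
    show ?thesis
    \<comment> \<open>As \<open>a\<close> is adjacent to all of \<open>N\<close>, it may join any
      class; 0 is always within the bound.\<close>
    proof (intro exI[of _ "f(a := 0)"] conjI ballI impI)
      fix x assume "x \<in> insert a N"
      then show "(f(a := 0)) x \<le> card (non_edges E (insert a N))"
        using f(1)[of x] mono by auto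
    next
      fix x y assume "x \<in> insert a N" "y \<in> insert a N"
        "(f(a := 0)) x = (f(a := 0)) y \<and> x \<noteq> y"
      then show "{x, y} \<in> E"
        using a f(2)[of x y] by (auto split: if_splits)
    qed
  next
    case True
    then obtain b where b: "b \<in> N" "{a, b} \<notin> E" by blast
    have "{a, b} \<in> non_edges E (insert a N)" "{a, b} \<notin> non_edges E N"
      using b insert.hyps by (auto simp: non_edges_def doubleton_eq_iff)
    then have "non_edges E N \<subset> non_edges E (insert a N)" using sub by blast
    then have less: "?m < card (non_edges E (insert a N))"
      using fin by (rule psubset_card_mono[rotated])
    show ?thesis
    proof (intro exI[of _ "f(a := Suc ?m)"] conjI ballI impI)
      fix x assume "x \<in> insert a N"
      then show "(f(a := Suc ?m)) x \<le> card (non_edges E (insert a N))"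
        using f(1)[of x] less by auto
    next
      fix x y assume "x \<in> insert a N" "y \<in> insert a N"
        "(f(a := Suc ?m)) x = (f(a := Suc ?m)) y \<and> x \<noteq> y"
      then show "{x, y} \<in> E"
        using f(1)[of x] f(1)[of y] f(2)[of x y] by (auto split: if_splits)
    qed
  qed
qed

section \<open>Prey assignments and the digraphs they define\<close>

text \<open>
  \<open>S w\<close> is the set of in-neighbours of \<open>w\<close> in the digraph under construction, and \<open>r\<close> is a
  height function witnessing its acyclicity.
\<close>

definition prey_assignment ::
    "'a set set \<Rightarrow> 'a set \<Rightarrow> nat \<Rightarrow> ('a + nat \<Rightarrow> 'a set) \<Rightarrow> ('a \<Rightarrow> nat) \<Rightarrow> bool" where
  "prey_assignment E V k S r \<longleftrightarrow>
     (\<forall>w. S w \<subseteq> V) \<and> (\<forall>w. \<forall>x\<in>S w. \<forall>y\<in>S w. x \<noteq> y \<longrightarrow> {x, y} \<in> E) \<and>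
     (\<forall>x. x \<notin> V \<longrightarrow> S (Inl x) = {}) \<and> (\<forall>j\<ge>k. S (Inr j) = {}) \<and>
     (\<forall>x\<in>V. \<forall>y\<in>V. {x, y} \<in> E \<longrightarrow> (\<exists>w. x \<in> S w \<and> y \<in> S w)) \<and>
     (\<forall>x y. x \<in> S (Inl y) \<longrightarrow> r x < r y) \<and> (\<forall>x\<in>V. r x < card V)"

lemma prey_assignment_exists:
  assumes E: "\<forall>e\<in>E. card e = 2" and "finite V"
  shows "\<exists>S r. prey_assignment E V (Suc (card (hole_sets E V))) S r"
  using assms(2)
proof (induction V rule: finite_psubset_induct)
  case (psubset V)
  show ?case
  proof (cases "V = {}")
    case True
    then have "prey_assignment E V (Suc (card (hole_sets E V))) (\<lambda>_. {}) (\<lambda>_. 0)"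
      by (simp add: prey_assignment_def)
    then show ?thesis by blast
  next
    case False
    then obtain v where v: "avoidable E V v"
      using avoidable_vertex_exists psubset.hyps by blast
    then have vV: "v \<in> V" by (simp add: avoidable_def)
    define V' where "V' = V - {v}"
    define N where "N = {x \<in> V. {v, x} \<in> E}"
    define h where "h = card (hole_sets E V')"
    define m where "m = card (non_edges E N)"
    have hm: "h + m \<le> card (hole_sets E V)"
      using card_hole_sets_delete_avoidable[OF psubset.hyps(1) E v]
      by (simp add: h_def m_def N_def V'_def)
    have irr: "{x, x} \<notin> E" for x using E by force
    have V: "V = insert v V'" "v \<notin> V'" "card V = Suc (card V')"
      using vV psubset.hyps by (auto simp: V'_def card_Suc_Diff1[symmetric] simp del: card_Diff_insert)
    have "V' \<subset> V" using V by auto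
    then obtain S r where S: "prey_assignment E V' (Suc h) S r"
      using psubset.IH h_def by blast
    have "finite N" using psubset.hyps by (simp add: N_def)
    then obtain f :: "'a \<Rightarrow> nat" where f: "\<And>x. x \<in> N \<Longrightarrow> f x \<le> m"
      "\<And>x y. x \<in> N \<Longrightarrow> y \<in> N \<Longrightarrow> f x = f y \<Longrightarrow> x \<noteq> y \<Longrightarrow> {x, y} \<in> E"
      using clique_partition[of N E] m_def by blast
    define K where "K j = insert v {x \<in> N. f x = j}" for j
    \<comment> \<open>The set of \<open>Inr h\<close>, the last added vertex used for
      \<open>V'\<close>, passes to \<open>Inl v\<close>. The freed index and the next
      \<open>m\<close> receive the cliques \<open>K 0\<close>, ..., \<open>K m\<close>, so
      \<open>h + m + 1\<close> added vertices suffice.\<close>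
    define S' where "S' w = (case w of
        Inl x \<Rightarrow> if x = v then S (Inr h) else S (Inl x)
      | Inr j \<Rightarrow> if j < h then S (Inr j) else if j \<le> h + m then K (j - h) else {})" for w
    \<comment> \<open>All prey of \<open>v\<close> are added vertices, so \<open>v\<close> can take
      a height above all of \<open>V'\<close>, where the predators it inherits lie.\<close>
    define r' where "r' = r(v := card V')"
    have S'_cases: "S' w = {} \<or> (\<exists>u. S' w = S u) \<or> (\<exists>j. S' w = K j)" for w
      by (cases w) (auto simp: S'_def)
    have S1: "S w \<subseteq> V'" "x \<in> S w \<Longrightarrow> y \<in> S w \<Longrightarrow> x \<noteq> y \<Longrightarrow> {x, y} \<in> E"
      "x \<notin> V' \<Longrightarrow> S (Inl x) = {}" "Suc h \<le> j \<Longrightarrow> S (Inr j) = {}"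
      "x \<in> V' \<Longrightarrow> y \<in> V' \<Longrightarrow> {x, y} \<in> E \<Longrightarrow> \<exists>w. x \<in> S w \<and> y \<in> S w"
      "x \<in> S (Inl y) \<Longrightarrow> r x < r y" "x \<in> V' \<Longrightarrow> r x < card V'" for w x y j
      using S unfolding prey_assignment_def by blast+
    have vertices: "S' w \<subseteq> V" for w
      using S'_cases[of w] S1(1) V vV by (auto simp: K_def N_def)
    have "{x, y} \<in> E" if "x \<in> K j" "y \<in> K j" "x \<noteq> y" for x y j
      using that f(2)[of x y] by (auto simp: K_def N_def insert_commute)
    then have clique: "{x, y} \<in> E" if "x \<in> S' w" "y \<in> S' w" "x \<noteq> y" for x y w
      using S'_cases[of w] that S1(2)[of x _ y] by auto
    have star: "\<exists>w. v \<in> S' w \<and> x \<in> S' w" if "x \<in> N" for x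
    proof -
      have "S' (Inr (h + f x)) = K (f x)" using f(1)[OF that] by (simp add: S'_def)
      then show ?thesis using that by (intro exI[of _ "Inr (h + f x)"]) (auto simp: K_def)
    qed
    \<comment> \<open>No nonempty set of the old assignment is lost: only that of
      \<open>Inr h\<close> moves, and that of \<open>Inl v\<close> was empty.\<close>
    have old: "\<exists>u. S' u = S w" if "x \<in> S w" for w x
    proof (cases w)
      case (Inl y)
      then have "y \<noteq> v" using S1(3)[of v] V(2) that by auto
      then have "S' (Inl y) = S w" using Inl by (simp add: S'_def)
      then show ?thesis by blast
    next
      case (Inr j)
      then have "j \<le> h" using S1(4)[of j] that by (cases "j \<le> h") auto
      then have "S' (if j = h then Inl v else Inr j) = S w" using Inr by (simp add: S'_def)
      then show ?thesis by blast
    qed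
    have cover: "\<exists>w. x \<in> S' w \<and> y \<in> S' w" if xy: "x \<in> V" "y \<in> V" "{x, y} \<in> E" for x y
    proof -
      consider "x = v" | "y = v" | "x \<in> V'" "y \<in> V'" using xy V by auto
      then show ?thesis
      proof cases
        case 1 then show ?thesis using star[of y] xy by (auto simp: N_def)
      next
        case 2 then show ?thesis using star[of x] xy by (auto simp: N_def insert_commute)
      next
        case 3 then show ?thesis using S1(5)[OF 3 xy(3)] old by metis
      qed
    qed
    have acyc: "r' x < r' y" if "x \<in> S' (Inl y)" for x y
    proof -
      have "x \<in> V'" using that S1(1) by (auto simp: S'_def split: if_splits)
      then show ?thesis
        using that S1(6)[of x y] S1(7)[of x] V(2) by (auto simp: S'_def r'_def split: if_splits)
    qed
    have "r' x < card V" if "x \<in> V" for x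
      using that S1(7)[of x] V by (auto simp: r'_def less_Suc_eq)
    moreover have "S' (Inl x) = {}" if "x \<notin> V" for x
      using that S1(3)[of x] V by (auto simp: S'_def)
    moreover have "S' (Inr j) = {}" if "Suc (card (hole_sets E V)) \<le> j" for j
      using that hm by (auto simp: S'_def)
    ultimately have "prey_assignment E V (Suc (card (hole_sets E V))) S' r'"
      unfolding prey_assignment_def using vertices clique cover acyc by blast
    then show ?thesis by blast
  qed
qed

lemma competition_digraph_of_prey_assignment:
  assumes E: "\<And>e. e \<in> E \<Longrightarrow> e \<subseteq> V \<and> card e = 2" and S: "prey_assignment E V k S r"
  shows "\<exists>D. acyclic_digraph D \<and> competition_graph D = add_isolated (V, E) k"
proof -
  define U :: "('a + nat) set" where "U = Inl ` V \<union> Inr ` {..<k}"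
  define A :: "(('a + nat) \<times> ('a + nat)) set" where "A = {(Inl x, w) | x w. x \<in> S w}"
  have S1: "S w \<subseteq> V" "x \<in> S w \<Longrightarrow> y \<in> S w \<Longrightarrow> x \<noteq> y \<Longrightarrow> {x, y} \<in> E"
    "x \<notin> V \<Longrightarrow> S (Inl x) = {}" "k \<le> j \<Longrightarrow> S (Inr j) = {}"
    "x \<in> V \<Longrightarrow> y \<in> V \<Longrightarrow> {x, y} \<in> E \<Longrightarrow> \<exists>w. x \<in> S w \<and> y \<in> S w"
    "x \<in> S (Inl y) \<Longrightarrow> r x < r y" "x \<in> V \<Longrightarrow> r x < card V" for w x y j
    using S unfolding prey_assignment_def by blast+
  have U: "w \<in> U" if "x \<in> S w" for x w
    using that S1(3) S1(4) by (cases w) (force simp: U_def not_le[symmetric])+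
  \<comment> \<open>Arcs raise the height \<open>r\<close>; added vertices have no prey and get
    height \<open>card V\<close>, above every vertex of \<open>V\<close>.\<close>
  have "A \<subseteq> measure (\<lambda>w. case w of Inl x \<Rightarrow> r x | Inr _ \<Rightarrow> card V)"
    using S1(6) S1(7)[OF subsetD[OF S1(1)]] by (auto simp: A_def split: sum.split)
  then have "acyclic A" using wf_acyclic acyclic_subset wf_measure by blast
  moreover have "A \<subseteq> U \<times> U" using U subsetD[OF S1(1)] by (auto simp: A_def U_def)
  ultimately have "acyclic_digraph (U, A)" by (simp add: acyclic_digraph_def)
  moreover have "{{x, y} | x y. x \<in> U \<and> y \<in> U \<and> x \<noteq> y \<and> (\<exists>w\<in>U. (x, w) \<in> A \<and> (y, w) \<in> A)}
      = (\<lambda>e. Inl ` e) ` E" (is "?L = ?R")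
  proof (intro equalityI subsetI)
    fix e assume "e \<in> ?L"
    then obtain x y w where "e = {Inl x, Inl y}" "x \<noteq> y" "x \<in> S w" "y \<in> S w"
      by (auto simp: A_def)
    then show "e \<in> ?R" using S1(2) by (intro image_eqI[of _ _ "{x, y}"]) auto
  next
    fix e assume "e \<in> ?R"
    then obtain x y where xy: "e = {Inl x, Inl y}" "x \<noteq> y" "{x, y} \<in> E"
      using E by (fastforce simp: card_2_iff)
    then obtain w where "x \<in> S w" "y \<in> S w" using S1(5) E by blast
    then have "Inl x \<in> U" "Inl y \<in> U" "w \<in> U" "(Inl x, w) \<in> A" "(Inl y, w) \<in> A"
      using U subsetD[OF S1(1)] by (auto simp: A_def U_def)
    then show "e \<in> ?L" using xy by blast
  qed
  ultimately show ?thesis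
    by (intro exI[of _ "(U, A)"]) (simp add: competition_graph_def add_isolated_def U_def)
qed

section \<open>The bound in terms of the number of holes\<close>

lemma card_holes: "card (holes (V, E)) = card (hole_sets E V)"
proof -
  have "holes (V, E) = (\<lambda>W. (W, {e \<in> E. e \<subseteq> W})) ` hole_sets E V"
    by (auto simp: holes_def hole_sets_def induced_subgraph_def)
  then show ?thesis by (simp add: card_image inj_on_def)
qed

theorem competition_number_le_Suc_card_holes:
  assumes "finite_simple_graph G"
  shows "competition_number G \<le> Suc (card (holes G))"
proof -
  obtain V E where G: "G = (V, E)" by (cases G)
  have V: "finite V" and E: "\<And>e. e \<in> E \<Longrightarrow> e \<subseteq> V \<and> card e = 2"
    using assms by (auto simp: G finite_simple_graph_def)
  then obtain S r where "prey_assignment E V (Suc (card (hole_sets E V))) S r"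
    using prey_assignment_exists[of E V] by blast
  then have "\<exists>D. acyclic_digraph D \<and> competition_graph D = add_isolated G (Suc (card (holes G)))"
    using competition_digraph_of_prey_assignment[OF E] by (simp add: G card_holes)
  then show ?thesis unfolding competition_number_def by (rule Least_le)
qed

theorem theorem4:
  fixes G :: "'a sgraph"
  assumes "finite_simple_graph G"
    and "card (holes G) = 2"
  shows "competition_number G \<le> 3"
  using competition_number_le_Suc_card_holes[OF assms(1)] assms(2) by simp

end
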